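(* Let $k$ and $n$ be nonnegative integers, and let $p_1,\dots,p_{k+1}$ be primes with $p_i\geq 3$ and $p_i\not\equiv 1\pmod 8$ for each $1\leq i\leq k+1$. Then for any integer $j\not\equiv 0\pmod{p_{k+1}}$, $$\overline{R_6^\ast}\left(18p_1^2\cdots p_{k+1}^2\, n + \frac{9p_1^2\cdots p_{k}^2\, p_{k+1}(4j+p_{k+1})-1}{4}\right)\equiv 0 \pmod{8}.$$
   Context: An overpartition of $n$ is a partition of $n$ in which the first occurrence of each part size may optionally be overlined. For a positive integer $\ell$, $\overline{R_\ell^\ast}(n)$ denotes the number of overpartitions of $n$ in which no non-overlined part is divisible by $\ell$ (and $\overline{R_\ell^\ast}(m)=0$ for negative integers $m$). Equivalently, with $f_k:=\prod_{i\geq 1}(1-q^{ki})$, one has $\sum_{n\geq 0}\overline{R_\ell^\ast}(n)q^n = \frac{f_2 f_\ell}{f_1^2}$. For $k=0$ the empty product $p_1^2\cdots p_k^2$ equals $1$. *)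

theory Defs
  imports "HOL-Number_Theory.Number_Theory" "HOL-Library.Multiset"
begin

text \<open>
  An overpartition is a pair \<open>(P, S)\<close>: \<open>P\<close> is the multiset of all parts and \<open>S\<close> the set of
  those part sizes whose first occurrence is overlined. Each size in \<open>S\<close> thus contributes
  exactly one overlined part.
\<close>

definition overpartitions :: "nat \<Rightarrow> (nat multiset \<times> nat set) set" where
  "overpartitions n = {(P, S). 0 \<notin># P \<and> sum_mset P = n \<and> S \<subseteq> set_mset P}"

definition nonoverlined :: "nat multiset \<times> nat set \<Rightarrow> nat multiset" where
  "nonoverlined \<pi> = fst \<pi> - mset_set (snd \<pi>)"

definition R_star :: "nat \<Rightarrow> int \<Rightarrow> nat" where
  "R_star l m =
     (if m < 0 then 0
      else card {\<pi> \<in> overpartitions (nat m). \<forall>d \<in># nonoverlined \<pi>. \<not> l dvd d})"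

text \<open>The cardinality in \<open>R_star\<close> is that of a finite set.\<close>

lemma finite_overpartitions: "finite (overpartitions n)"
proof -
  have size_le: "size P \<le> sum_mset P" if "0 \<notin># P" for P :: "nat multiset"
    using that by (induction P) auto
  have mem_le: "x \<le> sum_mset P" if "x \<in># P" for x and P :: "nat multiset"
    using that by (induction P) auto
  let ?M = "\<Union>k\<le>n. {P. set_mset P \<subseteq> {..n} \<and> size P = k}"
  have "finite {P. set_mset P \<subseteq> {..n} \<and> size P = k}" for k
  proof (rule finite_subset)
    show "{P. set_mset P \<subseteq> {..n} \<and> size P = k} \<subseteq>
            mset ` {xs. set xs \<subseteq> {..n} \<and> length xs = k}"
    proof
      fix P assume P: "P \<in> {P. set_mset P \<subseteq> {..n} \<and> size P = k}"
      obtain xs where "P = mset xs" by (metis ex_mset)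
      then show "P \<in> mset ` {xs. set xs \<subseteq> {..n} \<and> length xs = k}" using P by auto
    qed
    show "finite (mset ` {xs. set xs \<subseteq> {..n} \<and> length xs = k})"
      by (intro finite_imageI finite_lists_length_eq) simp
  qed
  then have "finite (?M \<times> Pow {..n})" by blast
  moreover have "overpartitions n \<subseteq> ?M \<times> Pow {..n}"
  proof
    fix \<pi> assume "\<pi> \<in> overpartitions n"
    then obtain P S where PS: "\<pi> = (P, S)" "0 \<notin># P" "sum_mset P = n" "S \<subseteq> set_mset P"
      unfolding overpartitions_def by blast
    have sub: "set_mset P \<subseteq> {..n}" using mem_le[of _ P] PS(3) by blast
    have "size P \<le> n" using size_le[OF PS(2)] PS(3) by simp
    then have "P \<in> ?M" using sub by blast
    moreover have "S \<in> Pow {..n}" using sub PS(4) by blast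
    ultimately show "\<pi> \<in> ?M \<times> Pow {..n}" using PS(1) by blast
  qed
  ultimately show ?thesis by (rule rev_finite_subset)
qed

text \<open>
  With \<open>a = p\<^sub>1 \<dots> p\<^sub>k\<close> and \<open>b = p\<^sub>k\<^sub>+\<^sub>1\<close>, the following shows that the integer division by 4
  in the theorem is exact.
\<close>

lemma four_dvd_argument:
  fixes a b j :: int
  assumes "odd a" "odd b"
  shows "4 dvd 9 * a\<^sup>2 * b * (4 * j + b) - 1"
proof -
  from assms obtain c d where "a = 2 * c + 1" "b = 2 * d + 1" by (meson oddE)
  then have "9 * a\<^sup>2 * b * (4 * j + b) - 1 =
      4 * (2 + 9 * a\<^sup>2 * b * j + 9 * (c\<^sup>2 + c) * b\<^sup>2 + 9 * (d\<^sup>2 + d))"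
    by (simp add: power2_eq_square algebra_simps)
  then show ?thesis by simp
qed

end

theory Submission
  imports
    Defs
    "HOL-Computational_Algebra.Formal_Power_Series"
    "HOL-Computational_Algebra.Nth_Powers"
begin

text \<open>
  Write \<open>\<phi> = 1 + 2 S\<close> with \<open>S = \<Sum>\<^sub>j\<^sub>\<ge>\<^sub>1 (-1)\<^sup>j q^(j\<^sup>2)\<close>. Gauss's identity \<open>\<phi> = f\<^sub>1\<^sup>2 / f\<^sub>2\<close> turns the generating
  function into \<open>f\<^sub>6 / \<phi>\<close>, which is \<open>f\<^sub>6 (1 - 2 S + 4 T)\<close> modulo 8 with \<open>T = \<Sum>\<^sub>j\<^sub>\<ge>\<^sub>1 q^(2 j\<^sup>2)\<close>. By
  Euler's pentagonal number theorem \<open>f\<^sub>6\<close> is supported on the exponents \<open>3 k (3 k + 1)\<close>, so in degrees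
  \<open>N\<close> congruent to 2 modulo 3 only \<open>4 f\<^sub>6 T\<close> survives, and the coefficient is 4 times the number of solutions
  of \<open>(6 k + 1)\<^sup>2 + 8 j\<^sup>2 = 4 N + 1\<close>, \<open>j \<ge> 1\<close>. If \<open>4 N + 1 = 9 L\<close>, dividing by a prime above 3 in \<open>\<int>[\<surd>-2]\<close>
  relates these solutions to the representations \<open>K = x\<^sup>2 + 2 y\<^sup>2\<close>, where \<open>K\<close> is the part of \<open>L\<close> prime to 3;
  when \<open>L\<close> is not a square, neither is \<open>K\<close>, no \<open>x\<close> or \<open>y\<close> vanishes, and the sign changes show that the number
  of solutions is even. In the theorem \<open>L\<close> contains \<open>p\<^sub>k\<^sub>+\<^sub>1\<close> to an odd power.
\<close>

section \<open>Finite forms of the identities of Gauss and Euler\<close>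

text \<open>Every summand of the correction carries \<open>q ^ (s * (n + 1))\<close> with s >= 1, so
  Gauss's identity appears as n grows. The induction works because, up to the new factor
  \<open>1 + q ^ Suc n\<close>, the correction changes by a sum that telescopes in s.\<close>

lemma gauss_square_sum_finite:
  fixes q :: "'a :: comm_ring_1"
  shows "(\<Prod>i=1..n. 1 + q ^ i) * (1 + 2 * (\<Sum>j=1..n. (-1) ^ j * q ^ (j\<^sup>2))) =
         (\<Prod>i=1..n. 1 - q ^ i) +
         2 * (\<Sum>s=1..n. (-1) ^ s * q ^ (s * (n + 1)) * (\<Prod>i=Suc s..n. 1 - q ^ i) * (\<Prod>i=1..<s. 1 + q ^ i))"
proof (induction n)
  case 0
  show ?case by simp
next
  case (Suc n)
  define D where "D s = (\<Prod>i=1..<s. 1 + q ^ i)" for s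
  define Q where "Q s = (\<Prod>i=s..n. 1 - q ^ i)" for s
  define A where "A m s = (-1) ^ s * q ^ (s * (m + 1)) * (\<Prod>i=Suc s..m. 1 - q ^ i) * D s" for m s
  \<comment> \<open>Telescoping certificate: \<open>E (Suc s) - E s\<close> equals
    \<open>A (Suc n) s - (1 + q ^ Suc n) * A n s\<close>.\<close>
  define E where "E s = (-1) ^ s * q ^ (s * (n + 1)) * Q s * D s" for s
  define F where "F m = 1 + 2 * (\<Sum>j=1..m. (-1) ^ j * q ^ (j\<^sup>2))" for m
  have D_Suc: "D (Suc s) = D s * (1 + q ^ s)" if "s \<ge> 1" for s
    using that by (simp add: D_def)
  have step: "A (Suc n) s - (1 + q ^ Suc n) * A n s = E (Suc s) - E s" if "s \<in> {1..n}" for s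
  proof -
    have 1: "(\<Prod>i=Suc s..Suc n. 1 - q ^ i) = Q (Suc s) * (1 - q ^ Suc n)"
      using that by (simp add: Q_def)
    have 2: "Q s = (1 - q ^ s) * Q (Suc s)"
      using that by (simp add: Q_def prod.atLeast_Suc_atMost)
    have 3: "D (Suc s) = D s * (1 + q ^ s)" using that D_Suc by simp
    have 4: "q ^ (s * (Suc n + 1)) = q ^ (s * (n + 1)) * q ^ s"
      by (simp flip: power_add add: algebra_simps)
    have 5: "q ^ (Suc s * (n + 1)) = q ^ (s * (n + 1)) * q ^ Suc n"
      by (simp flip: power_add add: algebra_simps)
    show ?thesis
      unfolding A_def E_def 1 2 3 4 5 unfolding Q_def[symmetric] 2
      by (simp add: algebra_simps)
  qed
  have sumA: "(\<Sum>s=1..n. A (Suc n) s) - (1 + q ^ Suc n) * (\<Sum>s=1..n. A n s) = E (Suc n) - E 1"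
  proof -
    have "(\<Sum>s=1..n. A (Suc n) s) - (1 + q ^ Suc n) * (\<Sum>s=1..n. A n s) =
          (\<Sum>s=1..n. E (Suc s) - E s)"
      unfolding sum_distrib_left sum_subtractf[symmetric] using step by (intro sum.cong) simp_all
    also have "\<dots> = E (Suc n) - E 1"
      by (induction n) auto
    finally show ?thesis .
  qed
  have D_n: "(\<Prod>i=1..m. 1 + q ^ i) = D (Suc m)" for m
    by (simp add: D_def atLeastLessThanSuc_atLeastAtMost)
  \<comment> \<open>The ends of the telescope supply the rest of the induction step:
    \<open>E 1\<close> turns \<open>1 + q ^ Suc n\<close> in front of \<open>Q 1\<close> into
    \<open>1 - q ^ Suc n\<close>, and \<open>E (Suc n)\<close> together with
    \<open>A (Suc n) (Suc n)\<close> is the new square term times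
    \<open>D (Suc n) * (1 + q ^ Suc n)\<close>.\<close>
  have E1: "E 1 = - (q ^ Suc n * Q 1)" by (simp add: E_def D_def)
  have En: "E (Suc n) = (-1) ^ Suc n * q ^ ((Suc n)\<^sup>2) * D (Suc n)"
    by (simp add: E_def Q_def power2_eq_square)
  have An: "A (Suc n) (Suc n) = (-1) ^ Suc n * q ^ ((Suc n)\<^sup>2) * q ^ Suc n * D (Suc n)"
  proof -
    have "q ^ (Suc n * (Suc n + 1)) = q ^ ((Suc n)\<^sup>2) * q ^ Suc n"
      by (simp flip: power_add add: algebra_simps power2_eq_square)
    then show ?thesis by (simp add: A_def)
  qed
  have IH: "D (Suc n) * F n = Q 1 + 2 * (\<Sum>s=1..n. A n s)"
    using Suc.IH by (simp only: D_n F_def A_def Q_def D_def)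
  have F_Suc: "F (Suc n) = F n + 2 * ((-1) ^ Suc n * q ^ ((Suc n)\<^sup>2))"
    by (simp add: F_def algebra_simps)
  have "D (Suc (Suc n)) * F (Suc n) =
      (1 + q ^ Suc n) * (D (Suc n) * F n) +
      2 * ((-1) ^ Suc n * q ^ ((Suc n)\<^sup>2)) * D (Suc n) * (1 + q ^ Suc n)"
    unfolding F_Suc using D_Suc[of "Suc n"] by (simp add: algebra_simps)
  also have "\<dots> = (1 - q ^ Suc n) * Q 1 +
       2 * ((1 + q ^ Suc n) * (\<Sum>s=1..n. A n s) + (E (Suc n) - E 1) + A (Suc n) (Suc n))"
    unfolding IH E1 En An by (simp add: algebra_simps)
  also have "\<dots> = (1 - q ^ Suc n) * Q 1 + 2 * (\<Sum>s=1..Suc n. A (Suc n) s)"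
    unfolding sumA[symmetric] by (simp add: algebra_simps)
  finally have "D (Suc (Suc n)) * F (Suc n) =
      (1 - q ^ Suc n) * Q 1 + 2 * (\<Sum>s=1..Suc n. A (Suc n) s)" .
  moreover have "(\<Prod>i=1..Suc n. 1 - q ^ i) = (1 - q ^ Suc n) * Q 1"
    by (simp add: Q_def mult.commute)
  ultimately show ?case
    by (simp only: D_n F_def A_def D_def)
qed

text \<open>
  The base is written as \<open>q = r\<^sup>2\<close>, so that the pentagonal exponent \<open>k (3k + 1) / 2\<close> of \<open>q\<close>
  needs no division.
\<close>

lemma euler_pentagonal_finite:
  fixes r :: "'a :: comm_ring_1"
  shows "(\<Sum>k=-int n..int n. (-1) ^ nat \<bar>k\<bar> * r ^ nat (k * (3 * k + 1))) =
         (\<Sum>s\<le>n. (-1) ^ s * (\<Prod>i=Suc s..n. 1 - r ^ (2 * i)) * r ^ (2 * s * n + s * (s + 1)))"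
proof (induction n)
  case 0
  show ?case by simp
next
  case (Suc n)
  define Q where "Q s = (\<Prod>i=s..n. 1 - r ^ (2 * i))" for s
  define B where "B m s = (-1) ^ s * (\<Prod>i=Suc s..m. 1 - r ^ (2 * i)) * r ^ (2 * s * m + s * (s + 1))" for m s
  \<comment> \<open>Again a telescoping certificate, now for \<open>B (Suc n) s - B n s\<close>. Its
    value 0 at s = 0 reflects the factor \<open>1 - r ^ 0\<close>, so the lower end contributes
    nothing.\<close>
  define H where "H s = (-1) ^ s * (if s = 0 then 0 else Q s) * r ^ (2 * s * n + s * (s + 1))" for s
  define g where "g k = (-1) ^ nat \<bar>k\<bar> * r ^ nat (k * (3 * k + 1))" for k
  have step: "B (Suc n) s - B n s = H (Suc s) - H s" if "s \<le> n" for s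
  proof -
    have 1: "(\<Prod>i=Suc s..Suc n. 1 - r ^ (2 * i)) = Q (Suc s) * (1 - r ^ (2 * n + 2))"
      using that by (simp add: Q_def)
    have 2: "(if s = 0 then 0 else Q s) = (1 - r ^ (2 * s)) * Q (Suc s)"
      using that by (simp add: Q_def prod.atLeast_Suc_atMost)
    have 4: "r ^ (2 * s * Suc n + s * (s + 1)) = r ^ (2 * s * n + s * (s + 1)) * r ^ (2 * s)"
      by (simp flip: power_add add: algebra_simps)
    have 5: "r ^ (2 * Suc s * n + Suc s * (Suc s + 1)) =
        r ^ (2 * s * n + s * (s + 1)) * r ^ (2 * s) * r ^ (2 * n + 2)"
      by (simp flip: power_add add: algebra_simps)
    show ?thesis
      unfolding B_def H_def 1 2 4 5 unfolding Q_def[symmetric]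
      by (simp add: algebra_simps)
  qed
  have "(\<Sum>s\<le>n. B (Suc n) s) - (\<Sum>s\<le>n. B n s) = (\<Sum>s\<le>n. H (Suc s) - H s)"
    using step by (simp flip: sum_subtractf)
  also have "\<dots> = H (Suc n) - H 0"
    by (induction n) auto
  finally have sumB: "(\<Sum>s\<le>n. B (Suc n) s) = (\<Sum>s\<le>n. B n s) + H (Suc n)"
    by (simp add: H_def algebra_simps)
  \<comment> \<open>The two new pentagonal terms are matched separately: k = -(n + 1) is the upper
    end \<open>H (Suc n)\<close> of the telescope, k = n + 1 is the new last summand
    \<open>B (Suc n) (Suc n)\<close>.\<close>
  have "nat ((- int n - 1) * (3 * (- int n - 1) + 1)) = 2 * Suc n * n + Suc n * (Suc n + 1)"
    by (rule nat_eq_iff[THEN iffD2]) (simp add: algebra_simps)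
  then have "g (- int (Suc n)) = (-1) ^ nat \<bar>- int (Suc n)\<bar> * r ^ (2 * Suc n * n + Suc n * (Suc n + 1))"
    unfolding g_def by (simp add: algebra_simps)
  then have g1: "g (- int (Suc n)) = H (Suc n)"
    unfolding H_def Q_def by (simp add: nat_add_distrib)
  have "nat (int (Suc n) * (3 * int (Suc n) + 1)) = 2 * Suc n * Suc n + Suc n * (Suc n + 1)"
    by (rule nat_eq_iff[THEN iffD2]) (simp add: algebra_simps)
  then have g2: "g (int (Suc n)) = B (Suc n) (Suc n)"
    unfolding g_def B_def by (simp add: nat_add_distrib)
  have "{-int (Suc n)..int (Suc n)} = insert (- int (Suc n)) (insert (int (Suc n)) {-int n..int n})"
    by auto
  then have "(\<Sum>k=-int (Suc n)..int (Suc n). g k) = g (- int (Suc n)) + (g (int (Suc n)) + (\<Sum>k=-int n..int n. g k))"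
    by simp
  also have "(\<Sum>k=-int n..int n. g k) = (\<Sum>s\<le>n. B n s)"
    using Suc.IH unfolding g_def B_def .
  also have "g (- int (Suc n)) + (g (int (Suc n)) + (\<Sum>s\<le>n. B n s)) = (\<Sum>s\<le>Suc n. B (Suc n) s)"
    unfolding g1 g2 by (simp add: sumB)
  finally show ?case unfolding g_def B_def .
qed

section \<open>Overpartitions as coefficients of power series\<close>

definition multisets_on :: "nat set \<Rightarrow> nat \<Rightarrow> nat multiset set" where
  "multisets_on I n = {P. set_mset P \<subseteq> I \<and> sum_mset P = n}"

lemma finite_multisets_on:
  assumes "0 \<notin> I"
  shows "finite (multisets_on I n)"
proof -
  have "(\<lambda>P. (P, {})) ` multisets_on I n \<subseteq> overpartitions n"
    using assms by (auto simp: multisets_on_def overpartitions_def)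
  then have "finite ((\<lambda>P. (P, {} :: nat set)) ` multisets_on I n)"
    by (rule finite_subset) (rule finite_overpartitions)
  then show ?thesis
    by (rule finite_imageD) (simp add: inj_on_def)
qed

definition multiset_fps :: "nat set \<Rightarrow> int fps" where
  "multiset_fps I = Abs_fps (\<lambda>n. int (card (multisets_on I n)))"

text \<open>Either \<open>a\<close> does not occur, or one copy of it can be removed; the remainder
  may contain \<open>a\<close> again. This is the combinatorial form of multiplication by
  \<open>1 - fps_X ^ a\<close>. The guard keeps the natural subtraction exact.\<close>

lemma multisets_on_insert:
  assumes "a \<notin> I"
  shows "multisets_on (insert a I) n =
    multisets_on I n \<union> (if a \<le> n then add_mset a ` multisets_on (insert a I) (n - a) else {})"
    (is "?L = ?R")
proof (intro equalityI subsetI)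
  fix P assume P: "P \<in> ?L"
  show "P \<in> ?R"
  proof (cases "a \<in># P")
    case True
    then obtain Q where "P = add_mset a Q" by (meson mset_add)
    with P show ?thesis by (auto simp: multisets_on_def)
  next
    case False
    with P show ?thesis by (auto simp: multisets_on_def)
  qed
next
  fix P assume "P \<in> ?R"
  then show "P \<in> ?L" by (auto simp: multisets_on_def split: if_splits)
qed

lemma card_multisets_on_insert:
  assumes "a \<notin> I" "0 \<notin> insert a I"
  shows "card (multisets_on (insert a I) n) =
    card (multisets_on I n) + (if a \<le> n then card (multisets_on (insert a I) (n - a)) else 0)"
proof -
  have "multisets_on I n \<inter> add_mset a ` multisets_on (insert a I) m = {}" for m
    using assms by (auto simp: multisets_on_def)
  moreover have "card (add_mset a ` multisets_on (insert a I) m) = card (multisets_on (insert a I) m)" for m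
    by (rule card_image) (simp add: inj_on_def)
  ultimately show ?thesis
    using assms by (subst multisets_on_insert) (auto simp: card_Un_disjoint finite_multisets_on)
qed

lemma multiset_fps_mult_prod:
  assumes "finite I" "0 \<notin> I"
  shows "multiset_fps I * (\<Prod>i\<in>I. 1 - fps_X ^ i) = 1"
  using assms
proof (induction I)
  case empty
  have "multisets_on {} n = (if n = 0 then {{#}} else {})" for n
    by (auto simp: multisets_on_def)
  then show ?case
    by (intro fps_ext) (simp add: multiset_fps_def)
next
  case (insert a I)
  have "multiset_fps (insert a I) = multiset_fps I + fps_X ^ a * multiset_fps (insert a I)"
  proof (rule fps_ext)
    fix n
    show "fps_nth (multiset_fps (insert a I)) n =
        fps_nth (multiset_fps I + fps_X ^ a * multiset_fps (insert a I)) n"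
      using card_multisets_on_insert[OF insert.hyps(2) insert.prems, of n]
      by (simp add: multiset_fps_def fps_X_power_mult_nth)
  qed
  then have "multiset_fps (insert a I) * (1 - fps_X ^ a) = multiset_fps I"
    by (simp add: algebra_simps)
  then show ?case
    using insert by (simp add: mult.assoc[symmetric])
qed

text \<open>Separating the overlined parts, a set \<open>S\<close>, from the non-overlined ones, a
  multiset avoiding multiples of \<open>l\<close>, is a bijection onto independent pairs. Parts
  above \<open>n\<close> cannot occur, so finite products suffice.\<close>

lemma R_star_eq_fps_nth:
  "int (R_star l (int n)) =
     fps_nth ((\<Prod>i=1..n. 1 + fps_X ^ i) * multiset_fps {i \<in> {1..n}. \<not> l dvd i}) n"
proof -
  let ?I = "{i \<in> {1..n}. \<not> l dvd i}"
  let ?T = "{S \<in> Pow {1..n}. \<Sum>S \<le> n}"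
  let ?A = "{\<pi> \<in> overpartitions n. \<forall>d \<in># nonoverlined \<pi>. \<not> l dvd d}"
  let ?B = "SIGMA S:?T. multisets_on ?I (n - \<Sum>S)"
  have mem_le: "x \<le> sum_mset P" if "x \<in># P" for x and P :: "nat multiset"
    using that by (induction P) auto
  have sum_set: "sum_mset (mset_set S) = \<Sum>S" for S :: "nat set"
    by (cases "finite S") (simp_all add: sum_unfold_sum_mset)
  have fin: "finite S" if "S \<subseteq> {1..n}" for S
    using that finite_subset by blast
  have "bij_betw (\<lambda>(P, S). (S, P - mset_set S)) ?A ?B"
  proof (rule bij_betw_byWitness[where f' = "\<lambda>(S, Q). (Q + mset_set S, S)"])
    have sub: "mset_set S \<subseteq># P" if "S \<subseteq> set_mset P" for P and S :: "nat set"
      using that by (meson finite_set_mset mset_set_set_mset_msubset msubset_mset_set_iff 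
          finite_subset subset_mset.order_trans)
    show "\<forall>a\<in>?A. (case (case a of (P, S) \<Rightarrow> (S, P - mset_set S)) of (S, Q) \<Rightarrow> (Q + mset_set S, S)) = a"
      using sub by (auto simp: overpartitions_def)
    show "\<forall>b\<in>?B. (case (case b of (S, Q) \<Rightarrow> (Q + mset_set S, S)) of (P, S) \<Rightarrow> (S, P - mset_set S)) = b"
      by auto
    show "(\<lambda>(P, S). (S, P - mset_set S)) ` ?A \<subseteq> ?B"
    proof (clarsimp simp: overpartitions_def nonoverlined_def)
      fix P S
      assume P: "0 \<notin># P" "S \<subseteq> set_mset P" "n = sum_mset P"
        and l: "\<forall>d\<in>#P - mset_set S. \<not> l dvd d"
      have set: "set_mset P \<subseteq> {Suc 0..sum_mset P}"
      proof
        fix x assume "x \<in># P"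
        with mem_le[OF this] P(1) show "x \<in> {Suc 0..sum_mset P}" by (cases x) auto
      qed
      have "sum_mset P = sum_mset (P - mset_set S) + \<Sum>S"
        using sub[OF P(2)] by (metis sum_mset.union subset_mset.diff_add sum_set)
      moreover have "set_mset (P - mset_set S) \<subseteq> set_mset P"
        by (meson in_diffD subsetI)
      ultimately show "S \<subseteq> {Suc 0..sum_mset P} \<and> \<Sum>S \<le> sum_mset P \<and>
          P - mset_set S \<in> multisets_on {i. Suc 0 \<le> i \<and> i \<le> sum_mset P \<and> \<not> l dvd i} (sum_mset P - \<Sum>S)"
        using set P(2) l unfolding multisets_on_def by auto
    qed
    show "(\<lambda>(S, Q). (Q + mset_set S, S)) ` ?B \<subseteq> ?A"
    proof (clarsimp simp: overpartitions_def nonoverlined_def)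
      fix Q S
      assume S: "S \<subseteq> {Suc 0..n}" "\<Sum>S \<le> n"
        and Q: "Q \<in> multisets_on {i. Suc 0 \<le> i \<and> i \<le> n \<and> \<not> l dvd i} (n - \<Sum>S)"
      have "finite S" using S(1) fin by simp
      then show "0 \<notin># Q \<and> 0 \<notin># mset_set S \<and> sum_mset Q + sum_mset (mset_set S) = n \<and>
          S \<subseteq> set_mset Q \<union> set_mset (mset_set S) \<and> (\<forall>d\<in>#Q. \<not> l dvd d)"
        using S Q by (auto simp: multisets_on_def sum_set)
    qed
  qed
  then have "card ?A = card ?B" by (rule bij_betw_same_card)
  also have "card ?B = (\<Sum>S\<in>?T. card (multisets_on ?I (n - \<Sum>S)))"
    by (rule card_SigmaI) (auto intro!: finite_multisets_on)
  finally have "int (R_star l (int n)) = (\<Sum>S\<in>?T. int (card (multisets_on ?I (n - \<Sum>S))))"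
    by (simp add: R_star_def)
  \<comment> \<open>Sets with sum above \<open>n\<close> contribute a zero coefficient; over the
    full power set the sum factors as a product.\<close>
  also have "\<dots> = (\<Sum>S\<in>Pow {1..n}. fps_nth (fps_X ^ \<Sum>S * multiset_fps ?I) n)"
    by (rule sum.mono_neutral_cong_left) (auto simp: fps_X_power_mult_nth multiset_fps_def)
  also have "\<dots> = fps_nth ((\<Sum>S\<in>Pow {1..n}. fps_X ^ \<Sum>S) * multiset_fps ?I) n"
    by (simp add: sum_distrib_right fps_sum_nth)
  also have "(\<Sum>S\<in>Pow {1..n}. fps_X ^ \<Sum>S) = (\<Prod>i=1..n. 1 + fps_X ^ i :: int fps)"
    using prod_add[of "{1..n}" "\<lambda>i. fps_X ^ i :: int fps" "\<lambda>_. 1"]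
    by (simp add: power_sum add.commute)
  finally show ?thesis .
qed

section \<open>Representations by x^2 + 2 y^2 and the prime 3\<close>

text \<open>The map injects each of the two classes into the other, so they have equal size. It is
  applied to sign changes of one coordinate.\<close>

lemma card_eq_twice_half:
  assumes "finite A" "f ` A \<subseteq> A" "inj_on f A" "\<And>a. a \<in> A \<Longrightarrow> P (f a) \<longleftrightarrow> \<not> P a"
  shows "card A = 2 * card {a \<in> A. P a}"
proof -
  have "card {a \<in> A. P a} \<le> card {a \<in> A. \<not> P a}"
    by (rule card_inj_on_le[of f]) (use assms in \<open>auto intro: inj_on_subset\<close>)
  moreover have "card {a \<in> A. \<not> P a} \<le> card {a \<in> A. P a}"
    by (rule card_inj_on_le[of f]) (use assms in \<open>auto intro: inj_on_subset\<close>)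
  moreover have "card A = card {a \<in> A. P a} + card {a \<in> A. \<not> P a}"
    using assms(1) by (subst card_Un_disjoint[symmetric]) (auto intro: arg_cong[where f = card])
  ultimately show ?thesis by simp
qed

definition reps :: "int \<Rightarrow> (int \<times> int) set" where
  "reps M = {(x, y). x\<^sup>2 + 2 * y\<^sup>2 = M}"

lemma finite_reps: "finite (reps M)"
proof -
  have "reps M \<subseteq> {-M..M} \<times> {-M..M}"
  proof clarify
    fix x y assume "(x, y) \<in> reps M"
    then have M: "x\<^sup>2 + 2 * y\<^sup>2 = M" by (simp add: reps_def)
    have le: "\<bar>z\<bar> \<le> z\<^sup>2" for z :: int
    proof (cases "z = 0")
      case False
      then have "\<bar>z\<bar> * 1 \<le> \<bar>z\<bar> * \<bar>z\<bar>" by (intro mult_left_mono) auto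
      then show ?thesis by (simp add: power2_eq_square)
    qed simp
    have "\<bar>x\<bar> \<le> M" "\<bar>y\<bar> \<le> M"
      using le[of x] le[of y] M zero_le_power2[of x] zero_le_power2[of y] by linarith+
    then show "x \<in> {-M..M} \<and> y \<in> {-M..M}" by auto
  qed
  then show ?thesis by (rule finite_subset) simp
qed

text \<open>x = 0 would make \<open>M\<close> even and y = 0 would make it a square, so the two sign
  changes act freely and the orbits have four elements.\<close>

lemma four_dvd_card_reps:
  assumes "odd M" "\<not> is_square M"
  shows "4 dvd card (reps M)"
proof -
  have nz: "x \<noteq> 0" "y \<noteq> 0" if "(x, y) \<in> reps M" for x y
    using that assms by (auto simp: reps_def is_nth_power_def)
  let ?A = "{a \<in> reps M. fst a > 0}"
  have "card (reps M) = 2 * card ?A"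
  proof (rule card_eq_twice_half[where f = "\<lambda>(x, y). (-x, y)"])
    show "\<And>a. a \<in> reps M \<Longrightarrow> (0 < fst (case a of (x, y) \<Rightarrow> (- x, y))) = (\<not> 0 < fst a)"
      using nz(1) by force
  qed (auto simp: finite_reps inj_on_def, auto simp: reps_def)
  also have "card ?A = 2 * card {a \<in> ?A. snd a > 0}"
  proof (rule card_eq_twice_half[where f = "\<lambda>(x, y). (x, -y)"])
    show "\<And>a. a \<in> ?A \<Longrightarrow> (0 < snd (case a of (x, y) \<Rightarrow> (x, - y))) = (\<not> 0 < snd a)"
      using nz(2) by force
  qed (auto simp: finite_reps inj_on_def, auto simp: reps_def)
  finally show ?thesis by simp
qed

text \<open>
  In \<open>\<int>[\<surd>-2]\<close> these are the elements of norm \<open>M\<close> that are divisible by \<open>1 - \<surd>-2\<close> but not by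
  \<open>1 + \<surd>-2\<close>, the two primes above 3.
\<close>

definition reps3 :: "int \<Rightarrow> (int \<times> int) set" where
  "reps3 M = {(x, y) \<in> reps M. \<not> 3 dvd x \<and> 3 dvd x + y}"

text \<open>The bijection is division by \<open>1 - \<surd>-2\<close>.\<close>

lemma card_reps3_triple: "card (reps3 (3 * M)) = card {(x, y) \<in> reps M. \<not> 3 dvd x - y}"
proof -
  \<comment> \<open>\<open>?g\<close> is multiplication of a + b sqrt(-2) by 1 - sqrt(-2).
    \<open>?f\<close> multiplies by the conjugate 1 + sqrt(-2) and divides by the norm 3, which is
    exact when 3 divides x + y.\<close>
  let ?f = "\<lambda>(x, y). ((x - 2 * y) div 3, (x + y) div 3) :: int \<times> int"
  let ?g = "\<lambda>(a, b). (a + 2 * b, b - a) :: int \<times> int"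
  have ex: "\<exists>a b. x = a + 2 * b \<and> y = b - a" if "3 dvd x + y" for x y :: int
  proof -
    from that obtain b where "x + y = 3 * b" by blast
    then have "x = (b - y) + 2 * b \<and> y = b - (b - y)" by simp
    then show ?thesis by blast
  qed
  have f: "?f (a + 2 * b, b - a) = (a, b)" for a b by (simp add: algebra_simps)
  have norm: "(a + 2 * b)\<^sup>2 + 2 * (b - a)\<^sup>2 = 3 * (a\<^sup>2 + 2 * b\<^sup>2)" for a b :: int
    by (simp add: power2_eq_square algebra_simps)
  have ndvd: "3 dvd a + 2 * b \<longleftrightarrow> 3 dvd a - b" for a b :: int by presburger
  have "bij_betw ?f (reps3 (3 * M)) {(x, y) \<in> reps M. \<not> 3 dvd x - y}"
  proof (rule bij_betw_byWitness[where f' = ?g])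
    show "\<forall>a\<in>reps3 (3 * M). ?g (?f a) = a"
      using ex f by (fastforce simp: reps3_def)
    show "\<forall>b\<in>{(x, y) \<in> reps M. \<not> 3 dvd x - y}. ?f (?g b) = b"
      using f by fastforce
    show "?f ` reps3 (3 * M) \<subseteq> {(x, y) \<in> reps M. \<not> 3 dvd x - y}"
    proof (rule image_subsetI)
      fix p assume p: "p \<in> reps3 (3 * M)"
      obtain x y where xy: "p = (x, y)" by (cases p)
      have "3 dvd x + y" using p by (simp add: xy reps3_def)
      then obtain a b where ab: "x = a + 2 * b" "y = b - a" using ex by blast
      from p have "(a, b) \<in> reps M \<and> \<not> 3 dvd a - b"
        unfolding xy ab by (simp add: reps3_def reps_def norm ndvd)
      then show "?f p \<in> {(x, y) \<in> reps M. \<not> 3 dvd x - y}"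
        unfolding xy ab f by simp
    qed
    show "?g ` {(x, y) \<in> reps M. \<not> 3 dvd x - y} \<subseteq> reps3 (3 * M)"
      by (auto simp: reps3_def reps_def norm ndvd)
  qed
  then show ?thesis by (rule bij_betw_same_card)
qed

text \<open>Modulo 3 the form is x^2 - y^2, which factors.\<close>

lemma three_dvd_norm_iff: "3 dvd x\<^sup>2 + 2 * y\<^sup>2 \<longleftrightarrow> 3 dvd x - y \<or> 3 dvd x + y" for x y :: int
proof -
  have "3 dvd x\<^sup>2 + 2 * y\<^sup>2 \<longleftrightarrow> 3 dvd (x - y) * (x + y)"
  proof -
    have "x\<^sup>2 + 2 * y\<^sup>2 = (x - y) * (x + y) + 3 * y\<^sup>2"
      by (simp add: power2_eq_square algebra_simps)
    then show ?thesis by (simp only: dvd_add_left_iff[OF dvd_triv_left])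
  qed
  then show ?thesis by (simp add: prime_dvd_mult_iff)
qed

text \<open>Each division by 1 - sqrt(-2) removes one factor 3 from the norm. The last one reaches
  all of \<open>reps K\<close>, since no element of norm prime to 3 is divisible by a prime above 3;
  there the sign changes apply.\<close>

lemma four_dvd_card_reps3:
  assumes "odd K" "\<not> 3 dvd K" "\<not> is_square K"
  shows "4 dvd card (reps3 (3 ^ Suc t * K))"
proof (induction t)
  case 0
  have "{(x, y) \<in> reps K. \<not> 3 dvd x - y} = reps K"
    using assms(2) three_dvd_norm_iff by (auto simp: reps_def)
  then show ?case using card_reps3_triple[of K] four_dvd_card_reps assms by simp
next
  case (Suc t)
  \<comment> \<open>A norm divisible by 3 forces divisibility by a prime above 3, so quotients not
    divisible by 1 + sqrt(-2) lie in \<open>reps3\<close> again.\<close>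
  have "3 dvd x - y \<longleftrightarrow> \<not> (\<not> 3 dvd x \<and> 3 dvd x + y)" if "(x, y) \<in> reps (3 ^ Suc t * K)" for x y
  proof -
    have "3 dvd x\<^sup>2 + 2 * y\<^sup>2" using that by (simp add: reps_def)
    then have "3 dvd x - y \<or> 3 dvd x + y" by (simp add: three_dvd_norm_iff)
    then show ?thesis by presburger
  qed
  then have "{(x, y) \<in> reps (3 ^ Suc t * K). \<not> 3 dvd x - y} = reps3 (3 ^ Suc t * K)"
    unfolding reps3_def by blast
  then show ?case using card_reps3_triple[of "3 ^ Suc t * K"] Suc.IH by (simp add: mult.assoc)
qed

text \<open>If the part \<open>K\<close> of \<open>L\<close> prime to 3 were a square, then
  \<open>L\<close> would be a square or 3 times a square. The latter is 0 or 3 modulo 4.\<close>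

lemma four_dvd_card_reps3_nine:
  assumes "L mod 4 = 1" "\<not> is_square L"
  shows "4 dvd card (reps3 (9 * L))"
proof -
  have "L \<noteq> 0" using assms(1) by auto
  then obtain K where K: "L = 3 ^ multiplicity 3 L * K" "\<not> 3 dvd K"
    using multiplicity_decompose'[of L 3] by auto
  define t where "t = multiplicity 3 L"
  have L: "L = 3 ^ t * K" using K(1) by (simp add: t_def)
  have "odd L" using assms(1) by presburger
  then have "odd K" using L by simp
  have "\<not> is_square K"
  proof
    assume "is_square K"
    then obtain z where z: "K = z\<^sup>2" by (auto simp: is_nth_power_def)
    show False
    proof (cases "even t")
      case True
      then obtain s where "t = 2 * s" by blast
      then have "L = (3 ^ s * z)\<^sup>2" by (simp add: L z power_mult_distrib power_mult mult.commute flip: power_mult)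
      then show False using assms(2) by (auto simp: is_nth_power_def)
    next
      case False
      then obtain s where "t = 2 * s + 1" by (rule oddE)
      then have eq: "L = 3 * (3 ^ s * z)\<^sup>2" by (simp add: L z power_mult_distrib flip: power_mult)
      have "w\<^sup>2 mod 4 = 0 \<or> w\<^sup>2 mod 4 = 1" for w :: int
      proof (cases "even w")
        case True
        then obtain c where "w = 2 * c" by blast
        then show ?thesis by (simp add: power2_eq_square)
      next
        case False
        then obtain c where "w = 2 * c + 1" by (rule oddE)
        then have "w\<^sup>2 = 1 + 4 * (c\<^sup>2 + c)" by (simp add: power2_eq_square algebra_simps)
        then show ?thesis by presburger
      qed
      from this[of "3 ^ s * z"] eq assms(1) show False by presburger
    qed
  qed
  then have "4 dvd card (reps3 (3 ^ Suc (Suc t) * K))"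
    using \<open>odd K\<close> K(2) four_dvd_card_reps3 by blast
  also have "3 ^ Suc (Suc t) * K = 9 * L" by (simp add: L)
  finally show ?thesis .
qed

section \<open>From representations of 9 L to solutions with a pentagonal exponent\<close>

text \<open>The index pairs of the terms of degree \<open>N\<close> in the product of the series for
  \<open>f_6\<close> and \<open>T\<close>, signs ignored.\<close>

definition pent_square_sols :: "int \<Rightarrow> (int \<times> int) set" where
  "pent_square_sols N = {(k, j). j \<ge> 1 \<and> 3 * k * (3 * k + 1) + 2 * j\<^sup>2 = N}"

text \<open>For 3 not dividing x, exactly one of x and -x satisfies the condition of
  \<open>reps3\<close>, and exactly one is 1 modulo 3; so the sign of x can be normalised by the
  residue instead. Then x = 6 k + 1 and y = 2 j, and choosing y > 0 accounts for the factor
  2.\<close>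

lemma card_reps3_nine:
  assumes "4 * N + 1 = 9 * L"
  shows "card (reps3 (9 * L)) = 2 * card (pent_square_sols N)"
proof -
  let ?W = "{a \<in> reps (9 * L). fst a mod 3 = 1}"
  let ?f = "\<lambda>(x, y). (if 3 dvd x + y then x else - x, y) :: int \<times> int"
  let ?g = "\<lambda>(x, y). (if x mod 3 = 1 then x else - x, y) :: int \<times> int"
  have dvd: "3 dvd x - y \<or> 3 dvd x + y" if "(x, y) \<in> reps (9 * L)" for x y
    using that three_dvd_norm_iff[of x y] by (simp add: reps_def)
  have "bij_betw ?f ?W (reps3 (9 * L))"
  proof (rule bij_betw_byWitness[where f' = ?g])
    have 1: "(- x) mod 3 \<noteq> 1" if "x mod 3 = 1" for x :: int
      using that by presburger
    have 2: "(- x) mod 3 = 1" if "\<not> 3 dvd x" "x mod 3 \<noteq> 1" for x :: int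
      using that by presburger
    have 3: "\<not> 3 dvd - x + y" if "\<not> 3 dvd x" "3 dvd x + y" for x y :: int
      using that by presburger
    show "\<forall>a\<in>?W. ?g (?f a) = a" using 1 by auto
    show "\<forall>a\<in>reps3 (9 * L). ?f (?g a) = a" using 3 by (auto simp: reps3_def)
    show "?f ` ?W \<subseteq> reps3 (9 * L)"
    proof (rule image_subsetI)
      fix a assume a: "a \<in> ?W"
      obtain x y where a_eq: "a = (x, y)" by (cases a)
      have xy: "(x, y) \<in> reps (9 * L)" "x mod 3 = 1" using a by (simp_all add: a_eq)
      have "(- x, y) \<in> reps (9 * L)" using xy by (simp add: reps_def)
      moreover have "\<not> 3 dvd x \<and> (\<not> 3 dvd x + y \<longrightarrow> 3 dvd - x + y)"
        using dvd[OF xy(1)] xy(2) by simp presburger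
      ultimately show "?f a \<in> reps3 (9 * L)" using xy by (auto simp: reps3_def a_eq)
    qed
    show "?g ` reps3 (9 * L) \<subseteq> ?W"
      using 2 by (auto simp: reps3_def reps_def)
  qed
  then have "card (reps3 (9 * L)) = card ?W" by (simp add: bij_betw_same_card)
  also have "\<dots> = 2 * card {a \<in> ?W. snd a > 0}"
  proof (rule card_eq_twice_half[where f = "\<lambda>(x, y). (x, - y)"])
    \<comment> \<open>y = 0 would make 3 divide x, so changing the sign of y has no fixed
      point.\<close>
    have "y \<noteq> 0" if "(x, y) \<in> reps (9 * L)" "x mod 3 = 1" for x y
      using dvd[OF that(1)] that(2) by presburger
    then show "\<And>a. a \<in> ?W \<Longrightarrow> (0 < snd ((\<lambda>(x, y). (x, - y)) a)) = (\<not> 0 < snd a)"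
      by force
  qed (auto simp: finite_reps inj_on_def, auto simp: reps_def)
  also have "card {a \<in> ?W. snd a > 0} = card (pent_square_sols N)"
  proof (rule bij_betw_same_card[symmetric])
    have norm: "(6 * k + 1)\<^sup>2 + 2 * (2 * j)\<^sup>2 = 4 * (3 * k * (3 * k + 1) + 2 * j\<^sup>2) + 1" for k j :: int
      by (simp add: power2_eq_square algebra_simps)
    have mod: "(6 * k + 1) mod 3 = 1" for k :: int by presburger
    show "bij_betw (\<lambda>(k, j). (6 * k + 1, 2 * j)) (pent_square_sols N) {a \<in> ?W. snd a > 0}"
    proof (rule bij_betwI')
      show "((case a of (k, j) \<Rightarrow> (6 * k + 1, 2 * j)) = (case b of (k, j) \<Rightarrow> (6 * k + 1, 2 * j))) = (a = b)"
        for a b :: "int \<times> int" by (auto split: prod.splits)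
      show "(case a of (k, j) \<Rightarrow> (6 * k + 1, 2 * j)) \<in> {a \<in> ?W. snd a > 0}"
        if a: "a \<in> pent_square_sols N" for a
      proof -
        obtain k j where kj: "a = (k, j)" by (cases a)
        have "(6 * k + 1)\<^sup>2 + 2 * (2 * j)\<^sup>2 = 9 * L"
          using a unfolding norm assms[symmetric] by (simp add: kj pent_square_sols_def)
        then show ?thesis
          using a mod by (simp add: kj reps_def pent_square_sols_def)
      qed
      fix b assume b: "b \<in> {a \<in> ?W. snd a > 0}"
      obtain x y where xy: "b = (x, y)" by (cases b)
      have eq: "x\<^sup>2 + 2 * y\<^sup>2 = 4 * N + 1" and x: "x mod 3 = 1" and "y > 0"
        using b assms by (auto simp: xy reps_def)
      have "odd (4 * N + 1)" by simp
      then have "odd x" unfolding eq[symmetric] by simp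
      then have "x mod 6 = 1" using x by presburger
      then obtain k where k: "x = 6 * k + 1" by (metis mult_div_mod_eq)
      \<comment> \<open>Since x^2 is 1 modulo 4, 4 divides 2 y^2, and y is even.\<close>
      have "4 * N + 1 = 4 * (9 * k\<^sup>2 + 3 * k) + 1 + 2 * y\<^sup>2"
        unfolding eq[symmetric] k by (simp add: power2_eq_square algebra_simps)
      then have "y\<^sup>2 = 2 * (N - (9 * k\<^sup>2 + 3 * k))" by simp
      then have "even (y\<^sup>2)" by simp
      then have "even y" by simp
      then obtain j where j: "y = 2 * j" by blast
      have "(k, j) \<in> pent_square_sols N"
        using eq \<open>y > 0\<close> unfolding k j norm by (simp add: pent_square_sols_def)
      then show "\<exists>a\<in>pent_square_sols N. b = (case a of (k, j) \<Rightarrow> (6 * k + 1, 2 * j))"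
        by (intro bexI[of _ "(k, j)"]) (auto simp: xy k j)
    qed
  qed
  finally show ?thesis .
qed

lemma even_card_pent_square_sols:
  assumes "4 * N + 1 = 9 * L" "\<not> is_square L"
  shows "even (card (pent_square_sols N))"
proof -
  have "L mod 4 = 1" using assms(1) by presburger
  then have "4 dvd 2 * card (pent_square_sols N)"
    using four_dvd_card_reps3_nine[of L] card_reps3_nine[OF assms(1)] assms(2) by simp
  then show ?thesis by presburger
qed

section \<open>Truncated power series and reduction modulo 8\<close>

text \<open>Cross terms come in pairs. Applied to \<open>S\<close>, this gives \<open>T\<close>
  modulo 2.\<close>

lemma power_two_sum:
  fixes f :: "'b \<Rightarrow> 'a :: comm_ring_1"
  assumes "finite A"
  shows "\<exists>c. (\<Sum>i\<in>A. f i)\<^sup>2 = (\<Sum>i\<in>A. (f i)\<^sup>2) + 2 * c"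
  using assms
proof (induction A)
  case (insert a A)
  then obtain c where c: "(\<Sum>i\<in>A. f i)\<^sup>2 = (\<Sum>i\<in>A. (f i)\<^sup>2) + 2 * c" by blast
  have "(\<Sum>i\<in>insert a A. f i)\<^sup>2 = (f a)\<^sup>2 + (\<Sum>i\<in>A. f i)\<^sup>2 + 2 * (f a * (\<Sum>i\<in>A. f i))"
    using insert.hyps by (simp add: power2_eq_square algebra_simps)
  also have "\<dots> = (\<Sum>i\<in>insert a A. (f i)\<^sup>2) + 2 * (c + f a * (\<Sum>i\<in>A. f i))"
    using insert.hyps by (simp add: c algebra_simps)
  finally show ?case by blast
qed (simp add: exI[of _ 0])

lemma fps_X_power_dvd_imp_nth_eq:
  fixes f g :: "'a :: comm_ring_1 fps"
  assumes "fps_X ^ m dvd f - g" "n < m"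
  shows "fps_nth f n = fps_nth g n"
proof -
  from assms(1) obtain h where "f - g = fps_X ^ m * h" by blast
  then have "fps_nth (f - g) n = 0" using assms(2) by (simp add: fps_X_power_mult_nth)
  then show ?thesis by simp
qed

lemma gauss_square_sum_cong:
  "fps_X ^ Suc n dvd (\<Prod>i=1..n. 1 + fps_X ^ i) * (1 + 2 * (\<Sum>j=1..n. (-1) ^ j * fps_X ^ (j\<^sup>2)))
      - (\<Prod>i=1..n. 1 - fps_X ^ i :: 'a :: comm_ring_1 fps)"
proof -
  have "Suc n \<le> s * (n + 1)" if "s \<in> {1..n}" for s
    using mult_le_mono1[of 1 s "n + 1"] that by simp
  then show ?thesis
    unfolding gauss_square_sum_finite add_diff_cancel_left'
    by (intro dvd_mult[where b = 2] dvd_sum dvd_mult2[OF dvd_mult2[OF dvd_mult]] le_imp_power_dvd)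
qed

text \<open>The summand s = 0 of the finite identity is the product itself; all others have exponent
  at least 2 (n + 1).\<close>

lemma euler_pentagonal_cong:
  fixes r :: "'a :: comm_ring_1"
  shows "r ^ (2 * Suc n) dvd (\<Sum>k=-int n..int n. (-1) ^ nat \<bar>k\<bar> * r ^ nat (k * (3 * k + 1)))
      - (\<Prod>i=1..n. 1 - r ^ (2 * i))"
proof -
  have "(\<Sum>s\<le>n. (-1) ^ s * (\<Prod>i=Suc s..n. 1 - r ^ (2 * i)) * r ^ (2 * s * n + s * (s + 1)))
      = (\<Prod>i=1..n. 1 - r ^ (2 * i)) +
        (\<Sum>s\<in>{..n} - {0}. (-1) ^ s * (\<Prod>i=Suc s..n. 1 - r ^ (2 * i)) * r ^ (2 * s * n + s * (s + 1)))"
    by (subst sum.remove[of _ 0]) simp_all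
  moreover have "2 * Suc n \<le> 2 * s * n + s * (s + 1)" if "s \<noteq> 0" for s
    using that by (cases s) auto
  ultimately show ?thesis
    by (simp only: euler_pentagonal_finite add_diff_cancel_left')
      (intro dvd_sum dvd_mult le_imp_power_dvd, simp)
qed

lemma fps_nth_sum_power_mult_sum_power:
  fixes a :: "'b \<Rightarrow> 'a :: comm_ring_1" and b :: "'c \<Rightarrow> 'a"
  shows "fps_nth ((\<Sum>k\<in>A. fps_const (a k) * fps_X ^ e k) * (\<Sum>j\<in>B. fps_const (b j) * fps_X ^ g j)) n =
    (\<Sum>(k, j)\<in>A \<times> B. if e k + g j = n then a k * b j else 0)"
proof -
  have "(\<Sum>k\<in>A. fps_const (a k) * fps_X ^ e k) * (\<Sum>j\<in>B. fps_const (b j) * fps_X ^ g j) =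
      (\<Sum>(k, j)\<in>A \<times> B. fps_const (a k * b j) * fps_X ^ (e k + g j))"
    unfolding sum_product sum.cartesian_product
    by (intro sum.cong) (auto simp: power_add mult_ac simp flip: fps_const_mult)
  then show ?thesis
    by (auto simp: fps_sum_nth case_prod_unfold fps_X_power_nth intro!: sum.cong)
qed

text \<open>The bounds 6 |k| <= 3 k (3 k + 1) and j <= j^2 confine all solutions to the box over
  which the truncated series are summed.\<close>

lemma card_pent_square_sols:
  "card (pent_square_sols (int N)) =
     card {(k, j) \<in> {-int (N div 6)..int (N div 6)} \<times> {1..N}. 3 * nat (k * (3 * k + 1)) + 2 * j\<^sup>2 = N}"
    (is "_ = card ?A")
proof (rule bij_betw_same_card)
  have pent: "6 * \<bar>k\<bar> \<le> 3 * k * (3 * k + 1)" for k :: int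
  proof (cases "k \<ge> 0")
    case True
    then have "k * 1 \<le> k * k" by (cases "k = 0") (auto intro: mult_left_mono)
    then show ?thesis using True by (simp add: algebra_simps)
  next
    case False
    then have "(- k) * 1 \<le> (- k) * (- k)" by (intro mult_left_mono) auto
    then show ?thesis using False by (simp add: algebra_simps)
  qed
  have iff: "3 * nat (k * (3 * k + 1)) + 2 * j\<^sup>2 = N \<longleftrightarrow> 3 * k * (3 * k + 1) + 2 * (int j)\<^sup>2 = int N" for k j
  proof -
    have "0 \<le> k * (3 * k + 1)" using pent[of k] by (simp add: mult.assoc)
    then have "int (3 * nat (k * (3 * k + 1)) + 2 * j\<^sup>2) = 3 * k * (3 * k + 1) + 2 * (int j)\<^sup>2"
      by simp
    then show ?thesis by (metis of_nat_eq_iff)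
  qed
  show "bij_betw (\<lambda>(k, j). (k, nat j)) (pent_square_sols (int N)) ?A"
  proof (rule bij_betw_byWitness[where f' = "\<lambda>(k, j). (k, int j)"])
    show "\<forall>a\<in>pent_square_sols (int N). (case case a of (k, j) \<Rightarrow> (k, nat j) of (k, j) \<Rightarrow> (k, int j)) = a"
      by (auto simp: pent_square_sols_def)
    show "\<forall>b\<in>?A. (case case b of (k, j) \<Rightarrow> (k, int j) of (k, j) \<Rightarrow> (k, nat j)) = b"
      by auto
    show "(\<lambda>(k, j). (k, int j)) ` ?A \<subseteq> pent_square_sols (int N)"
      by (auto simp: pent_square_sols_def iff)
    show "(\<lambda>(k, j). (k, nat j)) ` pent_square_sols (int N) \<subseteq> ?A"
    proof (rule image_subsetI)
      fix p assume p: "p \<in> pent_square_sols (int N)"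
      obtain k j where kj: "p = (k, j)" by (cases p)
      have j: "j \<ge> 1" and eq: "3 * k * (3 * k + 1) + 2 * j\<^sup>2 = int N"
        using p by (simp_all add: kj pent_square_sols_def)
      have "j * 1 \<le> j * j" using j by (intro mult_left_mono) auto
      then have "j \<le> j\<^sup>2" by (simp add: power2_eq_square)
      then have "6 * \<bar>k\<bar> \<le> int N" "j \<le> int N"
        using pent[of k] eq j by linarith+
      moreover from this have "\<bar>k\<bar> \<le> int (N div 6)" by linarith
      ultimately show "(\<lambda>(k, j). (k, nat j)) p \<in> ?A"
        using eq j by (auto simp: kj iff)
    qed
  qed
qed

text \<open>All identities hold modulo \<open>fps_X ^ Suc N\<close>. Multiplying Gauss's congruence
  by \<open>B\<close> cancels the product of the \<open>1 - fps_X ^ i\<close> down to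
  \<open>F\<close>, the truncation of \<open>f_6\<close>, which Euler's theorem replaces by
  \<open>E\<close>.\<close>

lemma R_star_6_cong:
  assumes "N mod 3 = 2"
  shows "[int (R_star 6 (int N)) = 4 * int (card (pent_square_sols (int N)))] (mod 8)"
proof -
  define M where "M = N div 6"
  define S :: "int fps" where "S = (\<Sum>j=1..N. (-1) ^ j * fps_X ^ (j\<^sup>2))"
  define T :: "int fps" where "T = (\<Sum>j=1..N. fps_X ^ (2 * j\<^sup>2))"
  define D :: "int fps" where "D = (\<Prod>i=1..N. 1 + fps_X ^ i)"
  define F :: "int fps" where "F = (\<Prod>i=1..M. 1 - (fps_X ^ 3) ^ (2 * i))"
  define E :: "int fps" where
    "E = (\<Sum>k=-int M..int M. (-1) ^ nat \<bar>k\<bar> * (fps_X ^ 3) ^ nat (k * (3 * k + 1)))"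
  define B where "B = multiset_fps {i \<in> {1..N}. \<not> 6 dvd i}"
  have B: "B * (\<Prod>i=1..N. 1 - fps_X ^ i) = F"
  proof -
    have "(\<Prod>i=1..N. 1 - fps_X ^ i) =
        (\<Prod>i\<in>{i \<in> {1..N}. \<not> 6 dvd i}. 1 - fps_X ^ i) * (\<Prod>i\<in>{i \<in> {1..N}. 6 dvd i}. 1 - fps_X ^ i :: int fps)"
      by (subst prod.union_disjoint[symmetric]) (auto intro!: prod.cong)
    moreover have "(\<Prod>i\<in>{i \<in> {1..N}. 6 dvd i}. 1 - fps_X ^ i) = F"
      unfolding F_def
      by (rule prod.reindex_bij_witness[of _ "\<lambda>i. 6 * i" "\<lambda>i. i div 6"])
        (auto simp: M_def simp flip: power_mult)
    ultimately show ?thesis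
      unfolding B_def by (simp add: multiset_fps_mult_prod flip: mult.assoc)
  qed
  have "fps_X ^ Suc N dvd B * (D * (1 + 2 * S) - (\<Prod>i=1..N. 1 - fps_X ^ i))"
    unfolding D_def S_def by (intro dvd_mult gauss_square_sum_cong)
  moreover have "fps_X ^ Suc N dvd E - F"
  proof -
    \<comment> \<open>With r = X^3 the pentagonal error has order at least 6 (N div 6 + 1), which
      exceeds N.\<close>
    have "fps_X ^ Suc N dvd (fps_X ^ 3 :: int fps) ^ (2 * Suc M)"
      unfolding power_mult[symmetric] M_def by (intro le_imp_power_dvd) presburger
    then show ?thesis
      unfolding E_def F_def by (rule dvd_trans) (rule euler_pentagonal_cong)
  qed
  ultimately have "fps_X ^ Suc N dvd B * (D * (1 + 2 * S) - (\<Prod>i=1..N. 1 - fps_X ^ i)) - (E - F)"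
    by (rule dvd_diff)
  also have "\<dots> = D * B * (1 + 2 * S) - E"
    using B by (simp add: algebra_simps)
  \<comment> \<open>The multiplier inverts \<open>1 + 2 * S\<close> modulo 8: their product is
    \<open>1 + 8 * S ^ 3\<close>.\<close>
  finally have "fps_X ^ Suc N dvd (D * B * (1 + 2 * S) - E) * (1 - 2 * S + 4 * S\<^sup>2)"
    by (rule dvd_mult2)
  moreover obtain c where c: "S\<^sup>2 = T + 2 * c"
  proof -
    have "(\<Sum>j=1..N. ((-1) ^ j * fps_X ^ (j\<^sup>2))\<^sup>2) = T"
      unfolding T_def by (simp add: power_mult_distrib mult.commute flip: power_mult)
    then show ?thesis
      using power_two_sum[of "{1..N}" "\<lambda>j. (-1) ^ j * fps_X ^ (j\<^sup>2) :: int fps"] that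
      unfolding S_def by auto
  qed
  have "(D * B * (1 + 2 * S) - E) * (1 - 2 * S + 4 * S\<^sup>2) =
      D * B - (E - 2 * (E * S) + 4 * (E * T) + 8 * (E * c - D * B * S ^ 3))"
  proof -
    have "(D * B * (1 + 2 * S) - E) * (1 - 2 * S + 4 * S\<^sup>2) =
        D * B + 8 * (D * B * S ^ 3) - E * (1 - 2 * S + 4 * S\<^sup>2)"
      by (simp add: algebra_simps power2_eq_square power3_eq_cube)
    then show ?thesis unfolding c by (simp add: algebra_simps)
  qed
  ultimately have R: "fps_nth (D * B) N =
      fps_nth (E - 2 * (E * S) + 4 * (E * T) + 8 * (E * c - D * B * S ^ 3)) N"
    by (intro fps_X_power_dvd_imp_nth_eq) auto
  have E: "E = (\<Sum>k=-int M..int M. fps_const ((-1) ^ nat \<bar>k\<bar>) * fps_X ^ (3 * nat (k * (3 * k + 1))))"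
    unfolding E_def by (simp add: power_mult flip: fps_const_power fps_const_neg fps_const_1_eq_1)
  \<comment> \<open>\<open>E\<close> has only exponents divisible by 3.\<close>
  have E0: "fps_nth E N = 0"
  proof -
    have "N \<noteq> 3 * m" for m using assms by presburger
    then show ?thesis unfolding E by (simp add: fps_sum_nth fps_X_power_nth)
  qed
  \<comment> \<open>Exponents of \<open>E * S\<close> are squares modulo 3, hence never 2.\<close>
  have ES0: "fps_nth (E * S) N = 0"
  proof -
    have S: "S = (\<Sum>j=1..N. fps_const ((-1) ^ j) * fps_X ^ (j\<^sup>2))"
      unfolding S_def by (simp flip: fps_const_power fps_const_neg fps_const_1_eq_1)
    have "3 * m + j\<^sup>2 \<noteq> N" for m j
    proof
      assume "3 * m + j\<^sup>2 = N"
      then have "j\<^sup>2 mod 3 = 2" using assms by presburger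
      then have "(j mod 3)\<^sup>2 mod 3 = 2" by (simp add: power_mod)
      moreover have "j mod 3 = 0 \<or> j mod 3 = 1 \<or> j mod 3 = 2" by presburger
      ultimately show False by auto
    qed
    then show ?thesis unfolding E S fps_nth_sum_power_mult_sum_power by (auto intro: sum.neutral)
  qed
  \<comment> \<open>This coefficient is later multiplied by 4, so parity suffices and the signs of
    \<open>E\<close> disappear.\<close>
  have "[fps_nth (E * T) N = int (card (pent_square_sols (int N)))] (mod 2)"
  proof -
    let ?I = "{-int M..int M} \<times> {1..N}"
    let ?P = "\<lambda>(k, j). 3 * nat (k * (3 * k + 1)) + 2 * j\<^sup>2 = N"
    have T: "T = (\<Sum>j=1..N. fps_const 1 * fps_X ^ (2 * j\<^sup>2))"
      unfolding T_def by simp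
    have sign: "[(-1) ^ m = (1 :: int)] (mod 2)" for m
      by (cases "even m") (simp_all add: cong_def)
    have "fps_nth (E * T) N = (\<Sum>a\<in>?I. if ?P a then (-1) ^ nat \<bar>fst a\<bar> else 0)"
      unfolding E T fps_nth_sum_power_mult_sum_power by (intro sum.cong) auto
    also have "[\<dots> = (\<Sum>a\<in>?I. if ?P a then 1 else 0)] (mod 2)"
      by (intro cong_sum) (simp add: sign)
    also have "(\<Sum>a\<in>?I. if ?P a then 1 else 0) = int (card {a \<in> ?I. ?P a})"
      by (subst sum.inter_filter[symmetric]) simp_all
    also have "{a \<in> ?I. ?P a} = {(k, j) \<in> ?I. 3 * nat (k * (3 * k + 1)) + 2 * j\<^sup>2 = N}"
      by auto
    also have "card \<dots> = card (pent_square_sols (int N))"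
      unfolding card_pent_square_sols M_def ..
    finally show ?thesis .
  qed
  then have "2 dvd fps_nth (E * T) N - int (card (pent_square_sols (int N)))"
    by (simp only: cong_iff_dvd_diff)
  then obtain d where d: "fps_nth (E * T) N = int (card (pent_square_sols (int N))) + 2 * d"
    by (metis add.commute diff_add_cancel dvdE)
  have "int (R_star 6 (int N)) = fps_nth (D * B) N"
    unfolding D_def B_def by (rule R_star_eq_fps_nth)
  also have "\<dots> = 4 * fps_nth (E * T) N + 8 * fps_nth (E * c - D * B * S ^ 3) N"
    using E0 ES0 unfolding R by (simp add: numeral_fps_const)
  also have "\<dots> - 4 * int (card (pent_square_sols (int N))) = 8 * (d + fps_nth (E * c - D * B * S ^ 3) N)"
    unfolding d by (simp only: algebra_simps)
  finally show ?thesis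
    by (simp only: cong_iff_dvd_diff dvd_triv_left)
qed

section \<open>Divisibility by 8 when 4 N + 1 is 9 times a non-square\<close>

lemma eight_dvd_R_star_6:
  assumes "4 * N + 1 = 9 * L" "\<not> is_square L"
  shows "8 dvd R_star 6 N"
\<comment> \<open>A negative \<open>j\<close> can make the argument negative, where
  \<open>R_star\<close> is 0 by convention.\<close>
proof (cases "N < 0")
  case False
  then obtain m where m: "N = int m" by (metis not_less zero_le_imp_eq_int)
  have "m mod 3 = 2" using assms(1) unfolding m by presburger
  then have "[int (R_star 6 N) = 4 * int (card (pent_square_sols N))] (mod 8)"
    unfolding m by (rule R_star_6_cong)
  moreover have "8 dvd 4 * int (card (pent_square_sols N))"
    using even_card_pent_square_sols[OF assms] by presburger
  ultimately have "int 8 dvd int (R_star 6 N)"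
    by (simp add: cong_dvd_iff)
  then show ?thesis by (simp only: of_nat_dvd_iff)
qed (simp add: R_star_def)

text \<open>After cancelling the square of \<open>a\<close>, the prime \<open>p\<close> divides the
  rest exactly once.\<close>

lemma not_is_square_times_square:
  fixes a c p :: int
  assumes "prime p" "\<not> p dvd c" "a \<noteq> 0"
  shows "\<not> is_square (a\<^sup>2 * (p * c))"
proof
  assume "is_square (a\<^sup>2 * (p * c))"
  then obtain z where z: "z\<^sup>2 = a\<^sup>2 * (p * c)" by (auto simp: is_nth_power_def)
  then have "a\<^sup>2 dvd z\<^sup>2" by simp
  then have "a dvd z" by simp
  then obtain w where "z = a * w" by blast
  then have w: "w\<^sup>2 = p * c" using z assms(3) by (simp add: power_mult_distrib)
  then have "p dvd w\<^sup>2" by simp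
  then have "p dvd w" using assms(1) prime_dvd_power by blast
  then obtain v where "w = p * v" by blast
  then have "c = p * v\<^sup>2"
    using w assms(1) by (simp add: power2_eq_square mult.assoc mult.left_commute)
  then show False using assms(2) by simp
qed

theorem theorem1p11:
  fixes k n :: nat and p :: "nat \<Rightarrow> nat" and j :: int
  assumes "\<And>i. i \<in> {1..k+1} \<Longrightarrow> prime (p i)"
    and "\<And>i. i \<in> {1..k+1} \<Longrightarrow> p i \<ge> 3"
    and "\<And>i. i \<in> {1..k+1} \<Longrightarrow> \<not> [p i = 1] (mod 8)"
    and "\<not> [j = 0] (mod int (p (k+1)))"
  shows "[R_star 6
            (18 * (\<Prod>i=1..k+1. (int (p i))\<^sup>2) * int n
             + (9 * (\<Prod>i=1..k. (int (p i))\<^sup>2) * int (p (k+1))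
                  * (4 * j + int (p (k+1))) - 1) div 4)
          = 0] (mod 8)"
proof -
  define a where "a = (\<Prod>i=1..k. int (p i))"
  define b where "b = int (p (k + 1))"
  \<comment> \<open>Chosen so that \<open>9 * L\<close> is four times the argument of
    \<open>R_star\<close> plus 1.\<close>
  define L where "L = a\<^sup>2 * (b * (8 * b * int n + 4 * j + b))"
  have odd: "odd (p i)" if "i \<in> {1..k+1}" for i
    using assms(1,2)[OF that] prime_odd_nat[of "p i"] by simp
  have "odd a" unfolding a_def using odd by (auto simp: even_prod_iff)
  have "odd b" unfolding b_def using odd by simp
  have "prime b" unfolding b_def using assms(1)[of "k + 1"] by simp
  have a2: "(\<Prod>i=1..k. (int (p i))\<^sup>2) = a\<^sup>2"
    unfolding a_def by (simp add: prod_power_distrib)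
  have ab2: "(\<Prod>i=1..k+1. (int (p i))\<^sup>2) = a\<^sup>2 * b\<^sup>2"
    using a2 by (simp add: b_def mult.commute)
  obtain m where m: "9 * a\<^sup>2 * b * (4 * j + b) - 1 = 4 * m"
    using four_dvd_argument[OF \<open>odd a\<close> \<open>odd b\<close>, of j] by blast
  have "4 * (18 * (a\<^sup>2 * b\<^sup>2) * int n + m) + 1 = 72 * (a\<^sup>2 * b\<^sup>2) * int n + (4 * m + 1)"
    by simp
  also have "4 * m + 1 = 9 * a\<^sup>2 * b * (4 * j + b)" using m by simp
  also have "72 * (a\<^sup>2 * b\<^sup>2) * int n + 9 * a\<^sup>2 * b * (4 * j + b) = 9 * L"
    by (simp add: L_def power2_eq_square algebra_simps)
  finally have "4 * (18 * (a\<^sup>2 * b\<^sup>2) * int n + m) + 1 = 9 * L" .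
  moreover have "\<not> is_square L"
    unfolding L_def
  proof (rule not_is_square_times_square)
    \<comment> \<open>Modulo \<open>b\<close> the cofactor is 4 j, and \<open>b\<close> is an odd
      prime not dividing \<open>j\<close>.\<close>
    show "\<not> b dvd 8 * b * int n + 4 * j + b"
    proof
      assume "b dvd 8 * b * int n + 4 * j + b"
      moreover have "8 * b * int n + 4 * j + b = b * (8 * int n + 1) + 2\<^sup>2 * j"
        by (simp add: algebra_simps)
      ultimately have "b dvd 2\<^sup>2 * j" by (simp only: dvd_add_right_iff[OF dvd_triv_left])
      then have "b dvd 2\<^sup>2 \<or> b dvd j" using \<open>prime b\<close> by (simp only: prime_dvd_mult_iff)
      moreover have "\<not> b dvd j" using assms(4) by (simp add: b_def cong_0_iff)
      ultimately have "b dvd 2" using \<open>prime b\<close> prime_dvd_power by blast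
      then show False using assms(2)[of "k + 1"] by (auto simp: b_def dest: zdvd_imp_le)
    qed
    show "a \<noteq> 0" using \<open>odd a\<close> by auto
  qed (rule \<open>prime b\<close>)
  ultimately have "8 dvd R_star 6 (18 * (a\<^sup>2 * b\<^sup>2) * int n + m)"
    by (rule eight_dvd_R_star_6)
  then show ?thesis
    unfolding a2 ab2 b_def[symmetric] m by (simp add: cong_0_iff)
qed

end
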